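(* Let $K\subseteq\mathbb{R}^n$ be compact and self-covering. Assume that there exists $v\in\mathbb{S}^{n-1}$ such that $K$ contains no non-trivial line segment in direction $v$. Then the Lipschitz dimension of $K$ is at most $n-1$.
   Context: Self-covering: for a compact set $K\subseteq\mathbb{R}^n$, a rescaled translate of $K$ is a set of the form $sK+v$ with $s>0$ and $v\in\mathbb{R}^n$. A compact set $K\subseteq\mathbb{R}^n$ is self-covering if there are constants $N\in\mathbb{N}$ and $C>0$ such that for each $x\in K$ and $r>0$ there are rescaled translates $K_1,\dots,K_M$ of $K$, contained in $K$, such that $M\le N$, $\mathrm{diam}(K_i)\le Cr$ for each $i$, and $\overline{B}(x,r)\cap K\subseteq\bigcup_iK_i$. Here $\overline{B}(x,r)$ is the closed ball and $\mathbb{S}^{n-1}$ the unit sphere in $\mathbb{R}^n$. Lipschitz dimension: for $r>0$, an $r$-path in a metric space $X$ is a finite sequence $(x_1,\dots,x_k)$ in $X$ with $d(x_i,x_{i+1})\le r$ for $1\le i\le k-1$. Two points are in the same $r$-component of $X$ if some $r$-path in $X$ contains both. The $r$-components of a subset are those of the subset as a metric space. A map $f\colon X\to Y$ is Lipschitz light if there is $C>0$ such that $f$ is $C$-Lipschitz and, for every $r>0$ and every $W\subset Y$ with $\mathrm{diam}(W)\le r$, the $r$-components of $f^{-1}(W)$ have diameter at most $Cr$. The Lipschitz dimension $\dim_L(X)$ is the minimal integer $n\ge0$ such that there is a Lipschitz light map $X\to\mathbb{R}^n$ (with $\mathbb{R}^0$ a one-point space), or $\infty$ if there is none. *)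

theory Defs
  imports "HOL-Analysis.Analysis" "HOL-Library.Extended_Nat"
begin

section \<open>Self-covering sets\<close>

definition rescaled_translate :: "'a::euclidean_space set \<Rightarrow> 'a set \<Rightarrow> bool" where
  "rescaled_translate K L \<longleftrightarrow> (\<exists>s>0. \<exists>v. L = (\<lambda>y. s *\<^sub>R y + v) ` K)"

text \<open>Intended for compact \<open>K\<close>, so that all diameters involved are those of bounded sets.\<close>

definition self_covering :: "'a::euclidean_space set \<Rightarrow> bool" where
  "self_covering K \<longleftrightarrow>
     (\<exists>N::nat. \<exists>C>0. \<forall>x\<in>K. \<forall>r>0. \<exists>M\<le>N. \<exists>L :: nat \<Rightarrow> 'a set.
        (\<forall>i<M. rescaled_translate K (L i) \<and> L i \<subseteq> K \<and> diameter (L i) \<le> C * r) \<and>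
        cball x r \<inter> K \<subseteq> (\<Union>i<M. L i))"


section \<open>Lipschitz dimension\<close>

text \<open>The diameter takes values in \<open>[0, \<infinity>]\<close>, so that unbounded sets have diameter \<open>\<infinity>\<close>;
  the library's \<open>diameter\<close> is unspecified for these. The empty set has diameter \<open>0\<close>.\<close>

definition mdiam :: "'a metric \<Rightarrow> 'a set \<Rightarrow> ennreal" where
  "mdiam X A = (SUP x\<in>A. SUP y\<in>A. ennreal (mdist X x y))"

definition is_rpath :: "'a metric \<Rightarrow> real \<Rightarrow> 'a list \<Rightarrow> bool" where
  "is_rpath X r xs \<longleftrightarrow> set xs \<subseteq> mspace X \<and> successively (\<lambda>x y. mdist X x y \<le> r) xs"

definition rconnected :: "'a metric \<Rightarrow> real \<Rightarrow> ('a \<times> 'a) set" where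
  "rconnected X r = {(x, y). \<exists>xs. is_rpath X r xs \<and> x \<in> set xs \<and> y \<in> set xs}"

definition rcomponents :: "'a metric \<Rightarrow> real \<Rightarrow> 'a set set" where
  "rcomponents X r = mspace X // rconnected X r"

definition lipschitz_light :: "'a metric \<Rightarrow> 'b metric \<Rightarrow> ('a \<Rightarrow> 'b) \<Rightarrow> bool" where
  "lipschitz_light X Y f \<longleftrightarrow> f \<in> mspace X \<rightarrow> mspace Y \<and>
     (\<exists>C>0.
        (\<forall>x\<in>mspace X. \<forall>y\<in>mspace X. mdist Y (f x) (f y) \<le> C * mdist X x y) \<and>
        (\<forall>r>0. \<forall>W\<subseteq>mspace Y. mdiam Y W \<le> ennreal r \<longrightarrow>
           (\<forall>U\<in>rcomponents (submetric X (f -` W)) r. mdiam X U \<le> ennreal (C * r))))"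

text \<open>The dimension of the target has to vary inside the definition of the Lipschitz dimension,
  so \<open>\<real>\<^sup>m\<close> is modelled, as in \<^const>\<open>Euclidean_space\<close>, by the real sequences vanishing
  from index \<open>m\<close> on, with the Euclidean distance. For \<open>m = 0\<close> this is a one-point space.\<close>

definition Rn_metric :: "nat \<Rightarrow> (nat \<Rightarrow> real) metric" where
  "Rn_metric m = metric ({x. \<forall>i\<ge>m. x i = 0}, \<lambda>x y. L2_set (\<lambda>i. x i - y i) {..<m})"

lemma Metric_space_Rn:
  "Metric_space {x. \<forall>i\<ge>m. x i = 0} (\<lambda>x y :: nat \<Rightarrow> real. L2_set (\<lambda>i. x i - y i) {..<m})"
proof
  fix x y z :: "nat \<Rightarrow> real"
  show "0 \<le> L2_set (\<lambda>i. x i - y i) {..<m}"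
    by simp
  show "L2_set (\<lambda>i. x i - y i) {..<m} = L2_set (\<lambda>i. y i - x i) {..<m}"
    by (simp add: L2_set_def power2_commute)
  show "L2_set (\<lambda>i. x i - y i) {..<m} = 0 \<longleftrightarrow> x = y"
    if "x \<in> {x. \<forall>i\<ge>m. x i = 0}" "y \<in> {x. \<forall>i\<ge>m. x i = 0}"
    using that by (auto simp: L2_set_eq_0_iff fun_eq_iff) (metis lessThan_iff not_le)
  show "L2_set (\<lambda>i. x i - z i) {..<m} \<le> L2_set (\<lambda>i. x i - y i) {..<m} + L2_set (\<lambda>i. y i - z i) {..<m}"
    using L2_set_triangle_ineq[of "\<lambda>i. x i - y i" "\<lambda>i. y i - z i" "{..<m}"] by simp
qed

lemma mspace_Rn_metric [simp]: "mspace (Rn_metric m) = {x. \<forall>i\<ge>m. x i = 0}"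
  by (simp add: Rn_metric_def Metric_space_Rn Metric_space.mspace_metric)

lemma mdist_Rn_metric [simp]:
  "mdist (Rn_metric m) = (\<lambda>x y. L2_set (\<lambda>i. x i - y i) {..<m})"
  by (simp add: Rn_metric_def Metric_space_Rn Metric_space.mdist_metric)

text \<open>An infimum over the empty set is \<open>\<infinity>\<close>; otherwise the infimum is attained.\<close>

definition lipschitz_dim :: "'a metric \<Rightarrow> enat" where
  "lipschitz_dim X = (INF m\<in>{m. \<exists>f. lipschitz_light X (Rn_metric m) f}. enat m)"

end

theory Submission
  imports Defs
begin

text \<open>
  Let \<open>p\<close> be the orthogonal projection along \<open>v\<close>, onto a hyperplane. The restriction of \<open>p\<close> to
  \<open>K\<close> is Lipschitz light; the hyperplane is isometric to \<open>\<real>\<close> to the power \<open>n - 1\<close>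
  (\<open>hyperplane_coordinates\<close>). What has to be bounded is the distance of two points that are joined
  by a chain of steps of length at most \<open>r\<close> in a subset of \<open>K\<close> whose image under \<open>p\<close> has
  diameter at most \<open>r\<close>.

  A soft bound comes from compactness: if chains with \<open>r\<close> tending to \<open>0\<close> joined points at
  distance at least \<open>\<epsilon>\<close>, a limit of these chains would contain a segment in \<open>K\<close> in direction \<open>v\<close>.
  Hence the distance is at most \<open>\<epsilon>\<close> as soon as \<open>r\<close> is at most some \<open>\<delta>\<close>
  (\<open>uniformly_light_compact\<close>). The same holds, with a common \<open>\<delta>\<close>, for all rescaled translates
  of \<open>K\<close> of bounded diameter (\<open>uniformly_light_rescaled_translates\<close>), and for the unions
  of boundedly many of these (\<open>uniformly_light_finite_unions\<close>).

  Self-covering turns this into a linear bound. After rescaling by \<open>1 / R\<close>, the part of \<open>K\<close> in a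
  ball of radius \<open>R\<close> lies in such a union, so for a suitable \<open>\<tau>\<close>, independent of the ball, a chain
  with \<open>r = \<tau> * R\<close> that starts at the centre and stays in the ball gets no further than \<open>R / 2\<close>.
  One more step does not leave the ball, so the chain never does, and the distance of its ends is
  at most \<open>R = r / \<tau>\<close> (\<open>self_covering_linear_light\<close>).
\<close>

section \<open>Chains in narrow sets\<close>

definition hop :: "'a::metric_space set \<Rightarrow> real \<Rightarrow> ('a \<times> 'a) set" where
  "hop A r = {(u, w). u \<in> A \<and> w \<in> A \<and> dist u w \<le> r}"

definition narrow :: "('a::real_normed_vector \<Rightarrow> 'a) \<Rightarrow> 'a set \<Rightarrow> real \<Rightarrow> bool" where
  "narrow p A r \<longleftrightarrow> (\<forall>u\<in>A. \<forall>w\<in>A. norm (p (u - w)) \<le> r)"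

text \<open>The condition is about subsets of the members so that it passes to intersections without a separate argument;
  it is about chains instead of components since chains are easy to transport and to cut.\<close>

definition uniformly_light :: "('a::real_normed_vector \<Rightarrow> 'a) \<Rightarrow> 'a set set \<Rightarrow> bool" where
  "uniformly_light p \<L> \<longleftrightarrow>
     (\<forall>\<epsilon>>0. \<exists>\<delta>>0. \<forall>L\<in>\<L>. \<forall>A\<subseteq>L. narrow p A \<delta> \<longrightarrow>
        (\<forall>x y. (x, y) \<in> (hop A \<delta>)\<^sup>* \<longrightarrow> dist x y \<le> \<epsilon>))"

lemma uniformly_lightD:
  assumes "uniformly_light p \<L>" "\<epsilon> > 0"
  obtains \<delta> where "\<delta> > 0"
    "\<And>L A x y. \<lbrakk>L \<in> \<L>; A \<subseteq> L; narrow p A \<delta>; (x, y) \<in> (hop A \<delta>)\<^sup>*\<rbrakk> \<Longrightarrow> dist x y \<le> \<epsilon>"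
proof -
  from assms obtain \<delta> where "\<delta> > 0" and "\<forall>L\<in>\<L>. \<forall>A\<subseteq>L. narrow p A \<delta> \<longrightarrow>
        (\<forall>x y. (x, y) \<in> (hop A \<delta>)\<^sup>* \<longrightarrow> dist x y \<le> \<epsilon>)"
    unfolding uniformly_light_def by meson
  then show thesis by (intro that[of \<delta>]) auto
qed

lemma uniformly_lightI:
  assumes "\<And>\<epsilon>. \<epsilon> > 0 \<Longrightarrow> \<exists>\<delta>>0. \<forall>L\<in>\<L>. \<forall>A\<subseteq>L. narrow p A \<delta> \<longrightarrow>
             (\<forall>x y. (x, y) \<in> (hop A \<delta>)\<^sup>* \<longrightarrow> dist x y \<le> \<epsilon>)"
  shows "uniformly_light p \<L>"
  unfolding uniformly_light_def by (intro allI impI assms)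

lemma hop_mono: "A \<subseteq> B \<Longrightarrow> r \<le> s \<Longrightarrow> hop A r \<subseteq> hop B s"
  by (auto simp: hop_def)

lemma hop_chain_mono: "(x, y) \<in> (hop A r)\<^sup>* \<Longrightarrow> A \<subseteq> B \<Longrightarrow> r \<le> s \<Longrightarrow> (x, y) \<in> (hop B s)\<^sup>*"
  by (rule subsetD[OF rtrancl_mono[OF hop_mono]])

lemma narrow_mono: "narrow p A r \<Longrightarrow> B \<subseteq> A \<Longrightarrow> r \<le> s \<Longrightarrow> narrow p B s"
  unfolding narrow_def by (meson order_trans subsetD)

lemma sym_hop_chain: "sym ((hop A r)\<^sup>*)"
  by (rule sym_rtrancl) (auto simp: sym_def hop_def dist_commute)

lemma hop_chain_in: "(x, y) \<in> (hop A r)\<^sup>* \<Longrightarrow> x = y \<or> x \<in> A \<and> y \<in> A"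
  by (induction rule: rtrancl_induct) (auto simp: hop_def)

lemma hop_chain_image:
  assumes "(x, y) \<in> (hop A r)\<^sup>*" and "\<And>u w. dist u w \<le> r \<Longrightarrow> dist (g u) (g w) \<le> s"
  shows "(g x, g y) \<in> (hop (g ` A) s)\<^sup>*"
  using assms(1)
proof (induction rule: rtrancl_induct)
  case (step y z)
  then have "(g y, g z) \<in> hop (g ` A) s"
    using assms(2) by (auto simp: hop_def)
  with step.IH show ?case
    by (rule rtrancl_into_rtrancl)
qed simp

text \<open>Unless \<open>h x = c\<close>, the first point of the chain with \<open>h\<close> at least \<open>c\<close> comes one step after a point with
  \<open>h\<close> below \<open>c\<close>, and a step changes \<open>h\<close> by at most \<open>r\<close>.\<close>

lemma hop_chain_intermediate_value:
  fixes h :: "'a::metric_space \<Rightarrow> real"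
  assumes "(x, y) \<in> (hop A r)\<^sup>*" and "x \<in> A" "r \<ge> 0"
    and lip: "\<And>u w. \<bar>h u - h w\<bar> \<le> dist u w"
    and "h x \<le> c" "c \<le> h y"
  shows "\<exists>u\<in>A. \<bar>h u - c\<bar> \<le> r"
  using assms(1,6)
proof (induction rule: rtrancl_induct)
  case base
  with assms(2,3,5) show ?case by (intro bexI[of _ x]) auto
next
  case (step y z)
  show ?case
  proof (cases "c \<le> h y")
    case True
    with step.IH show ?thesis .
  next
    case False
    with lip[of y z] step.hyps(2) step.prems show ?thesis
      by (intro bexI[of _ z]) (auto simp: hop_def)
  qed
qed

section \<open>Bounded unions\<close>

text \<open>A chain in \<open>A\<close> alternates between \<open>A \<inter> B\<close> and \<open>A - B\<close>. Each excursion into \<open>A - B\<close> has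
  diameter at most \<open>d\<close>, so two consecutive visits to \<open>B\<close> are at most \<open>d + 2 * t\<close> apart, and the
  visits to \<open>B\<close> form a chain for this coarser scale. The point \<open>z\<close> is where the last, possibly
  unfinished, excursion begins; it is \<open>x\<close> if \<open>B\<close> has not been visited.\<close>

lemma chain_in_union:
  assumes d: "\<And>u w. (u, w) \<in> (hop (A - B) t)\<^sup>* \<Longrightarrow> dist u w \<le> d"
    and "t \<ge> 0" and "(x, y) \<in> (hop A t)\<^sup>*"
  shows "\<exists>z. (z, y) \<in> (hop (A - B) t)\<^sup>* \<and>
           (z = x \<or> (\<exists>b b'. dist x b \<le> d + t \<and> (b, b') \<in> (hop (A \<inter> B) (d + 2 * t))\<^sup>* \<and>
                             b' \<in> A \<inter> B \<and> dist b' z \<le> t))"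
  using assms(3)
proof (induction rule: rtrancl_induct)
  case base
  then show ?case by blast
next
  case (step y z)
  let ?Q = "\<lambda>l e. \<exists>b b'. dist x b \<le> d + t \<and> (b, b') \<in> (hop (A \<inter> B) (d + 2 * t))\<^sup>* \<and>
                             b' \<in> A \<inter> B \<and> dist b' e \<le> l"
  have yz: "y \<in> A" "z \<in> A" "dist y z \<le> t"
    using step.hyps(2) by (auto simp: hop_def)
  obtain a where a: "(a, y) \<in> (hop (A - B) t)\<^sup>*" "a = x \<or> ?Q t a"
    using step.IH by blast
  have ay: "dist a y \<le> d"
    using a(1) by (rule d)
  \<comment> \<open>Needed for \<open>z\<close> if the step ends in \<open>B\<close>, and for \<open>y\<close> itself if the step leaves \<open>B\<close>.\<close>
  have in_B: "\<exists>b. dist x b \<le> d + t \<and> (b, w) \<in> (hop (A \<inter> B) (d + 2 * t))\<^sup>*"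
    if w: "w \<in> A \<inter> B" "dist y w \<le> t" for w
    using a(2)
  proof
    assume "a = x"
    with ay w dist_triangle[of x w y] show ?thesis
      by (intro exI[of _ w]) auto
  next
    assume "?Q t a"
    then obtain b b' where b: "dist x b \<le> d + t" "(b, b') \<in> (hop (A \<inter> B) (d + 2 * t))\<^sup>*"
      "b' \<in> A \<inter> B" "dist b' a \<le> t" by blast
    have "dist b' w \<le> d + 2 * t"
      using b(4) ay w(2) dist_triangle[of b' w a] dist_triangle[of a w y] by linarith
    with b w have "(b', w) \<in> hop (A \<inter> B) (d + 2 * t)"
      by (auto simp: hop_def)
    with b show ?thesis by (meson rtrancl_into_rtrancl)
  qed
  consider "z \<in> B" | "z \<notin> B" "y \<in> B" | "z \<notin> B" "y \<notin> B" by blast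
  then show ?case
  proof cases
    case 1
    with in_B[of z] yz \<open>t \<ge> 0\<close> show ?thesis
      by (intro exI[of _ z]) force
  next
    case 2
    with in_B[of y] yz \<open>t \<ge> 0\<close> show ?thesis
      by (intro exI[of _ z]) force
  next
    case 3
    with yz have "(y, z) \<in> hop (A - B) t" by (auto simp: hop_def)
    with a(1) have "(a, z) \<in> (hop (A - B) t)\<^sup>*" by (rule rtrancl_into_rtrancl)
    with a(2) show ?thesis by blast
  qed
qed

text \<open>The scales are chosen in reverse order: \<open>\<delta>B\<close> for the second family first, then a scale for
  the first family so fine that the excursions outside the member of the second family are short
  compared with \<open>\<delta>B\<close>.\<close>

lemma uniformly_light_union:
  assumes A: "uniformly_light p \<A>" and B: "uniformly_light p \<B>"
    and C: "\<And>C. C \<in> \<C> \<Longrightarrow> \<exists>A\<in>\<A>. \<exists>B\<in>\<B>. C \<subseteq> A \<union> B"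
  shows "uniformly_light p \<C>"
proof (rule uniformly_lightI)
  fix \<epsilon> :: real assume "\<epsilon> > 0"
  then obtain \<delta>B where \<delta>B: "\<delta>B > 0"
    "\<And>L A x y. \<lbrakk>L \<in> \<B>; A \<subseteq> L; narrow p A \<delta>B; (x, y) \<in> (hop A \<delta>B)\<^sup>*\<rbrakk> \<Longrightarrow> dist x y \<le> \<epsilon> / 3"
    using uniformly_lightD[OF B, of "\<epsilon> / 3"] by (metis divide_pos_pos zero_less_numeral)
  define d where "d = min (\<epsilon> / 6) (\<delta>B / 3)"
  have "d > 0" using \<open>\<epsilon> > 0\<close> \<delta>B(1) by (simp add: d_def)
  then obtain \<delta>A where \<delta>A: "\<delta>A > 0"
    "\<And>L A x y. \<lbrakk>L \<in> \<A>; A \<subseteq> L; narrow p A \<delta>A; (x, y) \<in> (hop A \<delta>A)\<^sup>*\<rbrakk> \<Longrightarrow> dist x y \<le> d"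
    using uniformly_lightD[OF A] by metis
  define t where "t = min \<delta>A d"
  have t: "t > 0" "t \<le> \<delta>A" "t \<le> d" and d: "6 * d \<le> \<epsilon>" "3 * d \<le> \<delta>B"
    using \<open>d > 0\<close> \<delta>A(1) by (auto simp: t_def d_def)
  have "dist x y \<le> \<epsilon>"
    if E: "E \<in> \<C>" and SE: "S \<subseteq> E" and nS: "narrow p S t" and xy: "(x, y) \<in> (hop S t)\<^sup>*" for E S x y
  proof -
    obtain L M where L: "L \<in> \<A>" and M: "M \<in> \<B>" and LM: "E \<subseteq> L \<union> M"
      using C[OF E] by blast
    have in_L: "dist u w \<le> d" if "(u, w) \<in> (hop (S - M) t)\<^sup>*" for u w
    proof (rule \<delta>A(2)[OF L])
      show "S - M \<subseteq> L" using SE LM by blast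
      show "narrow p (S - M) \<delta>A" by (rule narrow_mono[OF nS]) (use t in auto)
      show "(u, w) \<in> (hop (S - M) \<delta>A)\<^sup>*" using that t(2) hop_chain_mono by blast
    qed
    have in_M: "dist u w \<le> \<epsilon> / 3" if "(u, w) \<in> (hop (S \<inter> M) (d + 2 * t))\<^sup>*" for u w
    proof (rule \<delta>B(2)[OF M])
      show "S \<inter> M \<subseteq> M" by blast
      show "narrow p (S \<inter> M) \<delta>B" by (rule narrow_mono[OF nS]) (use t d in auto)
      show "(u, w) \<in> (hop (S \<inter> M) \<delta>B)\<^sup>*"
        by (rule hop_chain_mono[OF that]) (use t d in auto)
    qed
    obtain z where z: "(z, y) \<in> (hop (S - M) t)\<^sup>*"
      "z = x \<or> (\<exists>b b'. dist x b \<le> d + t \<and> (b, b') \<in> (hop (S \<inter> M) (d + 2 * t))\<^sup>* \<and>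
                             b' \<in> S \<inter> M \<and> dist b' z \<le> t)"
      using chain_in_union[OF in_L _ xy] t(1) by (meson less_imp_le)
    from z(2) show "dist x y \<le> \<epsilon>"
    proof
      assume "z = x"
      with in_L[OF z(1)] d \<open>d > 0\<close> show ?thesis by simp
    next
      assume "\<exists>b b'. dist x b \<le> d + t \<and> (b, b') \<in> (hop (S \<inter> M) (d + 2 * t))\<^sup>* \<and>
                             b' \<in> S \<inter> M \<and> dist b' z \<le> t"
      then obtain b b' where b: "dist x b \<le> d + t" "(b, b') \<in> (hop (S \<inter> M) (d + 2 * t))\<^sup>*"
        "dist b' z \<le> t" by blast
      have "dist x y \<le> dist x b + dist b b' + dist b' z + dist z y"
        using dist_triangle[of x y z] dist_triangle[of x z b'] dist_triangle[of x b' b] by linarith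
      with b in_M[OF b(2)] in_L[OF z(1)] d t \<open>d > 0\<close> show ?thesis by linarith
    qed
  qed
  with t(1) show "\<exists>\<delta>>0. \<forall>L\<in>\<C>. \<forall>A\<subseteq>L. narrow p A \<delta> \<longrightarrow>
             (\<forall>x y. (x, y) \<in> (hop A \<delta>)\<^sup>* \<longrightarrow> dist x y \<le> \<epsilon>)" by blast
qed

lemma uniformly_light_insert_empty:
  assumes "uniformly_light p \<L>"
  shows "uniformly_light p (insert {} \<L>)"
proof (rule uniformly_lightI)
  fix \<epsilon> :: real assume e: "\<epsilon> > 0"
  then obtain \<delta> where "\<delta> > 0"
    "\<And>L A x y. \<lbrakk>L \<in> \<L>; A \<subseteq> L; narrow p A \<delta>; (x, y) \<in> (hop A \<delta>)\<^sup>*\<rbrakk> \<Longrightarrow> dist x y \<le> \<epsilon>"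
    using uniformly_lightD[OF assms] by metis
  moreover have "dist x y \<le> \<epsilon>" if "(x, y) \<in> (hop {} \<delta>)\<^sup>*" for x y :: 'a
    using hop_chain_in[OF that] e by auto
  ultimately show "\<exists>\<delta>>0. \<forall>L\<in>insert {} \<L>. \<forall>A\<subseteq>L. narrow p A \<delta> \<longrightarrow>
             (\<forall>x y. (x, y) \<in> (hop A \<delta>)\<^sup>* \<longrightarrow> dist x y \<le> \<epsilon>)"
    by (intro exI[of _ \<delta>]) auto
qed

lemma uniformly_light_finite_unions:
  fixes N :: nat
  assumes "uniformly_light p \<L>"
  shows "uniformly_light p {\<Union>i<M. L i | M L. M \<le> N \<and> (\<forall>i<M. L i \<in> \<L>)}"
proof (induction N)
  case 0
  have "uniformly_light p (insert {} {})"
    by (rule uniformly_light_insert_empty) (auto simp: uniformly_light_def intro: exI[of _ 1])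
  moreover have "{\<Union>i<M. L i | M L. M \<le> (0::nat) \<and> (\<forall>i<M. L i \<in> \<L>)} = {{}}" by auto
  ultimately show ?case by simp
next
  case (Suc N)
  show ?case
  proof (rule uniformly_light_union[OF Suc uniformly_light_insert_empty[OF assms]])
    fix C assume "C \<in> {\<Union>i<M. L i | M L. M \<le> Suc N \<and> (\<forall>i<M. L i \<in> \<L>)}"
    then obtain M L where C: "C = (\<Union>i<M. L i)" "M \<le> Suc N" "\<forall>i<M. L i \<in> \<L>" by blast
    define A where "A = (\<Union>i<M - 1. L i)"
    define B where "B = (if M = 0 then {} else L (M - 1))"
    have "A \<in> {\<Union>i<M. L i | M L. M \<le> N \<and> (\<forall>i<M. L i \<in> \<L>)}"
      using C unfolding A_def by (intro CollectI exI[of _ "M - 1"] exI[of _ L]) auto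
    moreover have "B \<in> insert {} \<L>" using C by (auto simp: B_def)
    moreover have "C \<subseteq> A \<union> B"
      unfolding C(1) A_def B_def by (cases M) (auto simp: less_Suc_eq)
    ultimately show "\<exists>A\<in>{\<Union>i<M. L i | M L. M \<le> N \<and> (\<forall>i<M. L i \<in> \<L>)}. \<exists>B\<in>insert {} \<L>. C \<subseteq> A \<union> B"
      by blast
  qed
qed

section \<open>Compactness\<close>

text \<open>Otherwise there are ever finer chains in ever narrower subsets of \<open>K\<close> with ends at distance
  more than \<open>\<epsilon>\<close>. The limits \<open>a\<close> and \<open>b\<close> of their ends differ by a multiple of \<open>v\<close>, and by the
  intermediate value property every point between \<open>a\<close> and \<open>b\<close> is a limit of points of the chains,
  hence lies in \<open>K\<close>.\<close>

lemma uniformly_light_compact: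
  fixes K :: "'a::euclidean_space set"
  assumes K: "compact K" and v: "norm v = 1"
    and no_seg: "\<And>a t. t \<noteq> 0 \<Longrightarrow> \<not> closed_segment a (a + t *\<^sub>R v) \<subseteq> K"
  shows "uniformly_light (\<lambda>x. x - (x \<bullet> v) *\<^sub>R v) {K}"
proof (rule ccontr)
  define p where "p = (\<lambda>x. x - (x \<bullet> v) *\<^sub>R v)"
  have split: "x = p x + (x \<bullet> v) *\<^sub>R v" for x by (simp add: p_def)
  have cont_p: "isCont p x" for x unfolding p_def by (intro continuous_intros)
  assume "\<not> ?thesis"
  then obtain \<epsilon> where e: "\<epsilon> > 0" and bad: "\<And>\<delta>. \<delta> > 0 \<Longrightarrow> \<exists>A\<subseteq>K. narrow p A \<delta> \<and>
             (\<exists>x y. (x, y) \<in> (hop A \<delta>)\<^sup>* \<and> dist x y > \<epsilon>)"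
    unfolding uniformly_light_def p_def[symmetric] by (auto simp: not_le)
  \<comment> \<open>By symmetry of chains, the first end can be taken to be the lower one.\<close>
  have "\<exists>A x y. A \<subseteq> K \<and> narrow p A \<delta> \<and> (x, y) \<in> (hop A \<delta>)\<^sup>* \<and> dist x y > \<epsilon> \<and> x \<bullet> v \<le> y \<bullet> v"
    if \<delta>: "\<delta> > 0" for \<delta>
  proof -
    obtain A x y where "A \<subseteq> K" "narrow p A \<delta>" "(x, y) \<in> (hop A \<delta>)\<^sup>*" "dist x y > \<epsilon>"
      using bad[OF \<delta>] by blast
    moreover from this(3) have "(y, x) \<in> (hop A \<delta>)\<^sup>*" by (rule symD[OF sym_hop_chain])
    ultimately show ?thesis
      by (cases "x \<bullet> v \<le> y \<bullet> v") (blast, metis dist_commute linear)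
  qed
  then have "\<forall>k. \<exists>A x y. A \<subseteq> K \<and> narrow p A (inverse (Suc k)) \<and>
      (x, y) \<in> (hop A (inverse (Suc k)))\<^sup>* \<and> dist x y > \<epsilon> \<and> x \<bullet> v \<le> y \<bullet> v" by simp
  then obtain A x y where A: "\<And>k. A k \<subseteq> K" "\<And>k. narrow p (A k) (inverse (Suc k))"
    and xy: "\<And>k. (x k, y k) \<in> (hop (A k) (inverse (Suc k)))\<^sup>*" "\<And>k. dist (x k) (y k) > \<epsilon>"
      "\<And>k. x k \<bullet> v \<le> y k \<bullet> v" by metis
  have xyA: "x k \<in> A k" "y k \<in> A k" for k
    using hop_chain_in[OF xy(1)[of k]] xy(2)[of k] e by auto
  have "compact (K \<times> K)" using K by (simp add: compact_Times)
  moreover have "\<forall>k. (x k, y k) \<in> K \<times> K" using xyA A(1) by blast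
  ultimately obtain l \<rho> where l: "strict_mono \<rho>" "((\<lambda>k. (x k, y k)) \<circ> \<rho>) \<longlonglongrightarrow> l"
    by (meson compact_imp_seq_compact seq_compactE)
  define a b where "a = fst l" and "b = snd l"
  have lim: "(\<lambda>k. x (\<rho> k)) \<longlonglongrightarrow> a" "(\<lambda>k. y (\<rho> k)) \<longlonglongrightarrow> b"
    using tendsto_fst[OF l(2)] tendsto_snd[OF l(2)] by (simp_all add: o_def a_def b_def)
  have inv: "(\<lambda>k. inverse (real (Suc (\<rho> k)))) \<longlonglongrightarrow> 0"
    using LIMSEQ_subseq_LIMSEQ[OF LIMSEQ_inverse_real_of_nat l(1)] by (simp add: o_def)
  have p_lim: "p (w - a) = 0"
    if "(\<lambda>k. u (\<rho> k)) \<longlonglongrightarrow> w" "\<And>k. u k \<in> A k" for u w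
  proof -
    have "(\<lambda>k. p (u (\<rho> k) - x (\<rho> k))) \<longlonglongrightarrow> p (w - a)"
      by (intro isCont_tendsto_compose[OF cont_p] tendsto_diff that lim)
    moreover have "(\<lambda>k. p (u (\<rho> k) - x (\<rho> k))) \<longlonglongrightarrow> 0"
      by (rule Lim_null_comparison[OF always_eventually inv])
         (use A(2) xyA that(2) in \<open>auto simp: narrow_def\<close>)
    ultimately show ?thesis by (rule LIMSEQ_unique)
  qed
  define t where "t = (b - a) \<bullet> v"
  have b: "b = a + t *\<^sub>R v"
    using p_lim[OF lim(2) xyA(2)] by (simp add: t_def p_def algebra_simps)
  have "\<epsilon> \<le> dist a b"
    by (rule tendsto_lowerbound[OF tendsto_dist[OF lim] always_eventually])
       (simp_all add: xy(2) less_imp_le)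
  with e b have "t \<noteq> 0" by auto
  have "closed_segment a (a + t *\<^sub>R v) \<subseteq> K"
  proof
    fix z assume "z \<in> closed_segment a (a + t *\<^sub>R v)"
    then obtain s where s: "0 \<le> s" "s \<le> 1" and z: "z = a + (s * t) *\<^sub>R v"
      unfolding in_segment by (auto simp: algebra_simps)
    define c where "c k = x k \<bullet> v + s * (y k \<bullet> v - x k \<bullet> v)" for k
    have "\<exists>u\<in>A k. \<bar>u \<bullet> v - c k\<bar> \<le> inverse (Suc k)" for k
    proof (rule hop_chain_intermediate_value[OF xy(1)[of k] xyA(1)])
      show "\<bar>u \<bullet> v - w \<bullet> v\<bar> \<le> dist u w" for u w
        using Cauchy_Schwarz_ineq2[of "u - w" v] v by (simp add: dist_norm inner_diff_left)
      show "x k \<bullet> v \<le> c k" using s xy(3)[of k] by (simp add: c_def)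
      have "s * (y k \<bullet> v - x k \<bullet> v) \<le> 1 * (y k \<bullet> v - x k \<bullet> v)"
        using s xy(3)[of k] by (intro mult_right_mono) auto
      then show "c k \<le> y k \<bullet> v" by (simp add: c_def)
    qed auto
    then obtain u where u: "\<And>k. u k \<in> A k" "\<And>k. \<bar>u k \<bullet> v - c k\<bar> \<le> inverse (Suc k)" by metis
    have "(\<lambda>k. u (\<rho> k) \<bullet> v - c (\<rho> k)) \<longlonglongrightarrow> 0"
      by (rule Lim_null_comparison[OF always_eventually inv]) (use u(2) in auto)
    moreover have "(\<lambda>k. c (\<rho> k)) \<longlonglongrightarrow> a \<bullet> v + s * (b \<bullet> v - a \<bullet> v)"
      unfolding c_def by (intro tendsto_intros lim)
    ultimately have "(\<lambda>k. (u (\<rho> k) \<bullet> v - c (\<rho> k)) + c (\<rho> k)) \<longlonglongrightarrow> 0 + (a \<bullet> v + s * (b \<bullet> v - a \<bullet> v))"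
      by (rule tendsto_add)
    then have "(\<lambda>k. u (\<rho> k) \<bullet> v) \<longlonglongrightarrow> a \<bullet> v + s * t"
      by (simp add: t_def inner_diff_left)
    moreover have "(\<lambda>k. p (u (\<rho> k) - x (\<rho> k))) \<longlonglongrightarrow> 0"
      by (rule Lim_null_comparison[OF always_eventually inv])
         (use A(2) xyA u(1) in \<open>auto simp: narrow_def\<close>)
    moreover have "(\<lambda>k. p (x (\<rho> k))) \<longlonglongrightarrow> p a"
      by (rule isCont_tendsto_compose[OF cont_p lim(1)])
    ultimately have "(\<lambda>k. p (u (\<rho> k) - x (\<rho> k)) + p (x (\<rho> k)) + (u (\<rho> k) \<bullet> v) *\<^sub>R v)
        \<longlonglongrightarrow> 0 + p a + (a \<bullet> v + s * t) *\<^sub>R v"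
      by (intro tendsto_intros)
    then have "(\<lambda>k. u (\<rho> k)) \<longlonglongrightarrow> z"
      by (simp add: p_def z algebra_simps)
    moreover have "\<forall>k. u (\<rho> k) \<in> K" using u(1) A(1) by blast
    ultimately show "z \<in> K"
      by (meson closed_sequentially compact_imp_closed K)
  qed
  with no_seg \<open>t \<noteq> 0\<close> show False by blast
qed

section \<open>Rescaling\<close>

text \<open>Copies with a small factor \<open>s\<close> are so small that no two points are further than \<open>\<epsilon>\<close> apart. The bound
  \<open>S\<close> confines the remaining factors to a compact interval of positive numbers, on which the
  modulus of \<open>K\<close> can be rescaled uniformly.\<close>

lemma uniformly_light_rescaled_translates:
  assumes K: "bounded K" and light: "uniformly_light p {K}" and p: "linear p" and "S \<ge> 0"
  shows "uniformly_light p {L. rescaled_translate K L \<and> (\<forall>u\<in>L. \<forall>w\<in>L. dist u w \<le> S)}"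
proof (cases "\<exists>a\<in>K. \<exists>b\<in>K. a \<noteq> b")
  case False
  \<comment> \<open>For \<open>K\<close> with at most one point, \<open>S\<close> does not bound the factors, but there is nothing to do.\<close>
  have "dist x y \<le> \<epsilon>" if "rescaled_translate K L" "A \<subseteq> L" "(x, y) \<in> (hop A 1)\<^sup>*" "\<epsilon> > 0"
    for A L x y \<epsilon>
  proof -
    obtain s v where "L = (\<lambda>y. s *\<^sub>R y + v) ` K"
      using \<open>rescaled_translate K L\<close> unfolding rescaled_translate_def by blast
    moreover have "a = b" if "a \<in> K" "b \<in> K" for a b using that False by blast
    ultimately have "u = w" if "u \<in> L" "w \<in> L" for u w
      using that by (metis (no_types, lifting) imageE)
    then have "x = y" using hop_chain_in[OF that(3)] that(2) by blast
    then show ?thesis using that(4) by simp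
  qed
  then show ?thesis
    by (intro uniformly_lightI exI[of _ 1]) auto
next
  case True
  then obtain a b where ab: "a \<in> K" "b \<in> K" "a \<noteq> b" by blast
  define D where "D = dist a b"
  have D: "D > 0" using ab by (simp add: D_def)
  obtain B where B: "\<And>u w. u \<in> K \<Longrightarrow> w \<in> K \<Longrightarrow> dist u w \<le> B"
    using K bounded_two_points by metis
  have "B > 0" using B[of a b] ab D unfolding D_def by linarith
  show ?thesis
  proof (rule uniformly_lightI)
    fix \<epsilon> :: real assume e: "\<epsilon> > 0"
    \<comment> \<open>\<open>\<theta>\<close> separates the small factors from the others. The summand \<open>1\<close> in \<open>\<epsilon>'\<close> only keeps the
      denominator positive when \<open>S = 0\<close>.\<close>
    define \<theta> where "\<theta> = \<epsilon> / B"
    define \<epsilon>' where "\<epsilon>' = \<epsilon> / (S / D + 1)"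
    have SD: "S / D + 1 > 0" using \<open>S \<ge> 0\<close> D by (simp add: add_nonneg_pos)
    have \<theta>: "\<theta> > 0" and e': "\<epsilon>' > 0" using e \<open>B > 0\<close> SD by (auto simp: \<theta>_def \<epsilon>'_def)
    obtain \<delta> where d: "\<delta> > 0"
      and \<delta>: "\<And>A x y. \<lbrakk>A \<subseteq> K; narrow p A \<delta>; (x, y) \<in> (hop A \<delta>)\<^sup>*\<rbrakk> \<Longrightarrow> dist x y \<le> \<epsilon>'"
      using uniformly_lightD[OF light e'] by (metis singletonI)
    have "dist x y \<le> \<epsilon>" if L: "rescaled_translate K L" and small: "\<forall>u\<in>L. \<forall>w\<in>L. dist u w \<le> S"
      and A: "A \<subseteq> L" "narrow p A (\<theta> * \<delta>)" and xy: "(x, y) \<in> (hop A (\<theta> * \<delta>))\<^sup>*" for A L x y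
    proof -
      obtain s v where s: "s > 0" and L_eq: "L = (\<lambda>y. s *\<^sub>R y + v) ` K"
        using L unfolding rescaled_translate_def by blast
      define g where "g u = (1 / s) *\<^sub>R (u - v)" for u
      have g_diff: "g u - g w = (1 / s) *\<^sub>R (u - w)" for u w
        by (simp add: g_def algebra_simps)
      have dist_g: "dist (g u) (g w) = dist u w / s" for u w
        using s by (simp add: dist_norm g_diff)
      have gK: "g u \<in> K" if "u \<in> L" for u
        using that s by (auto simp: L_eq g_def)
      show ?thesis
      proof (cases "s \<le> \<theta>")
        case True
        show ?thesis
        proof (cases "x = y")
          case False
          then have "x \<in> L" "y \<in> L" using hop_chain_in[OF xy] A by auto
          then have "dist x y / s \<le> B" using B gK dist_g by metis
          then have "dist x y \<le> B * s" using s by (simp add: divide_le_eq)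
          also have "\<dots> \<le> B * \<theta>" using True \<open>B > 0\<close> by simp
          also have "\<dots> = \<epsilon>" using \<open>B > 0\<close> by (simp add: \<theta>_def)
          finally show ?thesis .
        qed (use e in simp)
      next
        case False
        have le: "\<theta> * \<delta> \<le> s * \<delta>" using False d by simp
        have "dist (g x) (g y) \<le> \<epsilon>'"
        proof (rule \<delta>)
          show "g ` A \<subseteq> K" using gK A(1) by blast
          show "narrow p (g ` A) \<delta>"
            unfolding narrow_def
          proof (intro ballI)
            fix u w assume "u \<in> g ` A" "w \<in> g ` A"
            then obtain u' w' where uw: "u = g u'" "w = g w'" "u' \<in> A" "w' \<in> A" by blast
            then have "norm (p (u' - w')) \<le> s * \<delta>" using A(2) le by (force simp: narrow_def)
            then show "norm (p (u - w)) \<le> \<delta>"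
              using s by (simp add: uw g_diff linear_scale[OF p] divide_le_eq mult.commute)
          qed
          show "(g x, g y) \<in> (hop (g ` A) \<delta>)\<^sup>*"
          proof (rule hop_chain_image[OF xy])
            show "dist (g u) (g w) \<le> \<delta>" if "dist u w \<le> \<theta> * \<delta>" for u w
              using that le s by (simp add: dist_g divide_le_eq mult.commute)
          qed
        qed
        then have "dist x y \<le> s * \<epsilon>'" using s by (simp add: dist_g divide_le_eq mult.commute)
        moreover have "s * D \<le> S"
        proof -
          have "dist (s *\<^sub>R a + v) (s *\<^sub>R b + v) \<le> S" using small ab L_eq by blast
          moreover have "dist (s *\<^sub>R a + v) (s *\<^sub>R b + v) = s * D"
            using s by (simp add: D_def dist_norm flip: scaleR_diff_right)
          ultimately show ?thesis by simp
        qed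
        then have "s \<le> S / D + 1" using D by (simp add: le_divide_eq add_increasing2)
        then have "s * \<epsilon>' \<le> (S / D + 1) * \<epsilon>'" using e' by simp
        moreover have "(S / D + 1) * \<epsilon>' = \<epsilon>" using SD by (simp add: \<epsilon>'_def)
        ultimately show ?thesis by linarith
      qed
    qed
    moreover have "\<theta> * \<delta> > 0" using \<theta> d by simp
    ultimately show "\<exists>\<delta>>0. \<forall>L\<in>{L. rescaled_translate K L \<and> (\<forall>u\<in>L. \<forall>w\<in>L. dist u w \<le> S)}.
        \<forall>A\<subseteq>L. narrow p A \<delta> \<longrightarrow> (\<forall>x y. (x, y) \<in> (hop A \<delta>)\<^sup>* \<longrightarrow> dist x y \<le> \<epsilon>)"
      by blast
  qed
qed

lemma rescaled_translate_scale:
  assumes "rescaled_translate K L" "c > 0"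
  shows "rescaled_translate K ((\<lambda>u. c *\<^sub>R u) ` L)"
proof -
  obtain s v where "s > 0" "L = (\<lambda>y. s *\<^sub>R y + v) ` K"
    using assms(1) unfolding rescaled_translate_def by blast
  then have "c * s > 0" "(\<lambda>u. c *\<^sub>R u) ` L = (\<lambda>y. (c * s) *\<^sub>R y + c *\<^sub>R v) ` K"
    using assms(2) by (auto simp: image_image scaleR_add_right)
  then show ?thesis unfolding rescaled_translate_def by blast
qed

text \<open>A chain that starts at \<open>x\<close> is compared with the ball of radius \<open>R = r / \<tau>\<close> about \<open>x\<close>. The
  covering of this ball becomes, after division by \<open>R\<close>, a member of one fixed uniformly light
  family, whatever \<open>x\<close> and \<open>r\<close> are; this is why \<open>\<tau>\<close> can be chosen once and for all.\<close>

proposition self_covering_linear_light: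
  assumes K: "bounded K" and cov: "self_covering K"
    and light: "uniformly_light p {K}" and p: "linear p"
  obtains C where "C \<ge> 1"
    "\<And>r A x y. \<lbrakk>r > 0; A \<subseteq> K; narrow p A r; (x, y) \<in> (hop A r)\<^sup>*\<rbrakk> \<Longrightarrow> dist x y \<le> C * r"
proof -
  obtain N S where S: "S > 0" and cover: "\<And>x r. x \<in> K \<Longrightarrow> r > 0 \<Longrightarrow> \<exists>M\<le>N. \<exists>L :: nat \<Rightarrow> 'a set.
        (\<forall>i<M. rescaled_translate K (L i) \<and> L i \<subseteq> K \<and> diameter (L i) \<le> S * r) \<and>
        cball x r \<inter> K \<subseteq> (\<Union>i<M. L i)"
    using cov unfolding self_covering_def by metis
  define \<L> where "\<L> = {L. rescaled_translate K L \<and> (\<forall>u\<in>L. \<forall>w\<in>L. dist u w \<le> S)}"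
  define \<U> where "\<U> = {\<Union>i<M. L i | M L. M \<le> N \<and> (\<forall>i<M. L i \<in> \<L>)}"
  have "uniformly_light p \<U>"
    unfolding \<U>_def \<L>_def using S
    by (intro uniformly_light_finite_unions uniformly_light_rescaled_translates K light p) simp
  then obtain \<delta> where d: "\<delta> > 0"
    and \<delta>: "\<And>L A x y. \<lbrakk>L \<in> \<U>; A \<subseteq> L; narrow p A \<delta>; (x, y) \<in> (hop A \<delta>)\<^sup>*\<rbrakk> \<Longrightarrow> dist x y \<le> 1 / 2"
    by (rule uniformly_lightD[of p \<U> "1 / 2"]) (simp, blast)
  \<comment> \<open>\<open>\<tau> \<le> 1 / 2\<close> makes a step of length \<open>r\<close> from within \<open>R / 2\<close> stay in the ball.\<close>
  define \<tau> where "\<tau> = min \<delta> (1 / 2)"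
  have \<tau>: "\<tau> > 0" "\<tau> \<le> \<delta>" "\<tau> \<le> 1 / 2" using d by (auto simp: \<tau>_def)
  show ?thesis
  proof
    show "1 / \<tau> \<ge> 1" using \<tau> by (simp add: le_divide_eq)
    fix r A x y
    assume r: "r > (0::real)" and A: "A \<subseteq> K" "narrow p A r" and xy: "(x, y) \<in> (hop A r)\<^sup>*"
    define R where "R = r / \<tau>"
    have R: "R > 0" "r / R = \<tau>" "r \<le> R / 2"
      using r \<tau> by (auto simp: R_def field_simps)
    define g where "g u = (1 / R) *\<^sub>R u" for u :: 'a
    have g_diff: "g u - g w = (1 / R) *\<^sub>R (u - w)" for u w
      by (simp add: g_def algebra_simps)
    have dist_g: "dist (g u) (g w) = dist u w / R" for u w
      using R by (simp add: dist_norm g_diff)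
    show "dist x y \<le> 1 / \<tau> * r"
    proof (cases "x = y")
      case False
      then have "x \<in> K" using hop_chain_in[OF xy] A by blast
      then obtain M L where M: "M \<le> N"
        and L: "\<forall>i<M. rescaled_translate K (L i) \<and> L i \<subseteq> K \<and> diameter (L i) \<le> S * R"
        and LM: "cball x R \<inter> K \<subseteq> (\<Union>i<M. L i)"
        using cover[OF \<open>x \<in> K\<close> R(1)] by (elim exE conjE) (rule that)
      have gL: "g ` L i \<in> \<L>" if "i < M" for i
      proof -
        have "rescaled_translate K (g ` L i)"
          unfolding g_def by (rule rescaled_translate_scale) (use L that R in auto)
        moreover have "dist u w \<le> S * R" if "u \<in> L i" "w \<in> L i" for u w
          using diameter_bounded_bound[OF bounded_subset[OF K] that] L \<open>i < M\<close> by force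
        ultimately show ?thesis using R(1)
          by (auto simp: \<L>_def dist_g divide_le_eq)
      qed
      have U: "(\<Union>i<M. g ` L i) \<in> \<U>"
        unfolding \<U>_def using M gL by (intro CollectI exI[of _ M] exI[of _ "\<lambda>i. g ` L i"]) auto
      define E where "E = A \<inter> cball x R"
      have half: "dist x w \<le> R / 2" if "(x, w) \<in> (hop E r)\<^sup>*" for w
      proof -
        have "dist (g x) (g w) \<le> 1 / 2"
        proof (rule \<delta>[OF U])
          have "E \<subseteq> (\<Union>i<M. L i)" using LM A(1) by (auto simp: E_def)
          then show "g ` E \<subseteq> (\<Union>i<M. g ` L i)" by blast
          show "narrow p (g ` E) \<delta>"
            unfolding narrow_def
          proof (intro ballI)
            fix u w assume "u \<in> g ` E" "w \<in> g ` E"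
            then obtain u' w' where uw: "u = g u'" "w = g w'" "u' \<in> A" "w' \<in> A"
              by (auto simp: E_def)
            then have "norm (p (u' - w')) / R \<le> r / R"
              using A(2) R(1) by (intro divide_right_mono) (auto simp: narrow_def)
            then show "norm (p (u - w)) \<le> \<delta>"
              using R \<tau>(2) by (simp add: uw g_diff linear_scale[OF p])
          qed
          have "dist (g u) (g w) \<le> \<delta>" if "dist u w \<le> r" for u w
            using divide_right_mono[OF that, of R] R \<tau>(2) by (simp add: dist_g)
          with that show "(g x, g w) \<in> (hop (g ` E) \<delta>)\<^sup>*" by (rule hop_chain_image)
        qed
        then show ?thesis using R by (simp add: dist_g divide_le_eq)
      qed
      have "(x, y) \<in> (hop E r)\<^sup>*"
        using xy
      proof (induction rule: rtrancl_induct)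
        case (step w z)
        have "dist x w \<le> R / 2" by (rule half[OF step.IH])
        with step.hyps(2) R dist_triangle[of x z w] have "(w, z) \<in> hop E r"
          by (auto simp: hop_def E_def)
        with step.IH show ?case by (rule rtrancl_into_rtrancl)
      qed simp
      from half[OF this] R(1) show ?thesis by (simp add: R_def)
    qed (use r \<tau> in simp)
  qed
qed

section \<open>Coordinates on the hyperplane\<close>

text \<open>The coordinates with respect to an orthonormal basis of the hyperplane orthogonal to \<open>v\<close>.
  By Parseval they identify it isometrically with \<open>\<real>\<close> to the power \<open>DIM('a) - 1\<close>.\<close>

lemma hyperplane_coordinates:
  fixes v :: "'a::euclidean_space"
  assumes "norm v = 1"
  obtains f :: "'a \<Rightarrow> nat \<Rightarrow> real" where
    "\<And>x i. i \<ge> DIM('a) - 1 \<Longrightarrow> f x i = 0"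
    "\<And>x y. L2_set (\<lambda>i. f x i - f y i) {..<DIM('a) - 1} = norm ((x - y) - ((x - y) \<bullet> v) *\<^sub>R v)"
proof -
  define H where "H = {x. v \<bullet> x = 0}"
  have vv: "v \<bullet> v = 1" and "v \<noteq> 0" using assms by (auto simp: norm_eq_1)
  have "subspace H" unfolding H_def by (rule subspace_hyperplane)
  then obtain B where B: "B \<subseteq> H" "pairwise orthogonal B" "\<And>x. x \<in> B \<Longrightarrow> norm x = 1"
    "independent B" "card B = dim H" "span B = H"
    using orthonormal_basis_subspace by metis
  have "finite B" using B(4) independent_imp_finite by blast
  have card: "card B = DIM('a) - 1"
    using B(5) dim_hyperplane[OF \<open>v \<noteq> 0\<close>] by (simp add: H_def)
  then obtain e where e: "bij_betw e {..<DIM('a) - 1} B"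
    using ex_bij_betw_nat_finite[OF \<open>finite B\<close>] by (auto simp: atLeast0LessThan)
  define f where "f x i = (if i < DIM('a) - 1 then x \<bullet> e i else 0)" for x i
  have "L2_set (\<lambda>i. f x i - f y i) {..<DIM('a) - 1} = norm ((x - y) - ((x - y) \<bullet> v) *\<^sub>R v)" for x y
  proof -
    define z where "z = (x - y) - ((x - y) \<bullet> v) *\<^sub>R v"
    have "z \<in> span B"
      unfolding B(6) H_def z_def using vv by (simp add: inner_diff_right inner_commute)
    then have z: "(\<Sum>b\<in>B. (z \<bullet> b) *\<^sub>R b) = z"
      by (intro orthonormal_basis_expand B(2,3) \<open>finite B\<close>)
    have zb: "z \<bullet> b = (x - y) \<bullet> b" if "b \<in> B" for b
    proof -
      have "b \<bullet> v = 0" using that B(1) by (auto simp: H_def inner_commute)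
      then show ?thesis by (simp add: z_def inner_diff_right inner_diff_left inner_commute)
    qed
    have "(norm z)\<^sup>2 = (\<Sum>b\<in>B. (z \<bullet> b)\<^sup>2)"
    proof -
      have "(norm z)\<^sup>2 = z \<bullet> z" by (rule power2_norm_eq_inner)
      also have "\<dots> = z \<bullet> (\<Sum>b\<in>B. (z \<bullet> b) *\<^sub>R b)" by (simp only: z)
      finally show ?thesis by (simp add: inner_sum_right power2_eq_square)
    qed
    also have "\<dots> = (\<Sum>b\<in>B. ((x - y) \<bullet> b)\<^sup>2)" using zb by simp
    also have "\<dots> = (\<Sum>i<DIM('a) - 1. ((x - y) \<bullet> e i)\<^sup>2)"
      by (rule sum.reindex_bij_betw[OF e, symmetric])
    also have "\<dots> = (\<Sum>i<DIM('a) - 1. (f x i - f y i)\<^sup>2)"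
      by (simp add: f_def inner_diff_left)
    finally show ?thesis
      unfolding L2_set_def z_def by (intro real_sqrt_unique) simp_all
  qed
  then show ?thesis by (intro that[of f]) (simp_all add: f_def)
qed

section \<open>Lipschitz light maps and Lipschitz dimension\<close>

lemma rpath_hop_chain:
  assumes "is_rpath X r xs" "x \<in> set xs" "y \<in> set xs"
    and "mspace X \<subseteq> A" "\<And>u w. mdist X u w = dist u w"
  shows "(x, y) \<in> (hop A r)\<^sup>*"
proof -
  have "(hd xs, z) \<in> (hop A r)\<^sup>*" if "z \<in> set xs" for z
    using assms(1) that
  proof (induction xs arbitrary: z)
    case (Cons a xs)
    show ?case
    proof (cases "z = a")
      case False
      then have z: "z \<in> set xs" and "xs \<noteq> []" using Cons.prems by auto
      have "set (a # xs) \<subseteq> A"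
        using Cons.prems(1) assms(4) unfolding is_rpath_def by blast
      moreover have "hd xs \<in> set xs" using \<open>xs \<noteq> []\<close> by (rule hd_in_set)
      ultimately have "a \<in> A" "hd xs \<in> A" by auto
      with \<open>xs \<noteq> []\<close> have "is_rpath X r xs" "(a, hd xs) \<in> hop A r"
        using Cons.prems(1) assms(5) by (auto simp: is_rpath_def successively_Cons hop_def)
      with Cons.IH z show ?thesis by (auto intro: converse_rtrancl_into_rtrancl)
    qed simp
  qed simp
  with assms(2,3) show ?thesis
    using sym_hop_chain[of A r] by (meson rtrancl_trans symD)
qed

theorem theorem5p16:
  fixes K :: "(real ^ 'n) set"
  assumes "compact K" and "self_covering K"
    and "\<exists>v \<in> sphere (0 :: real ^ 'n) 1.
           \<not> (\<exists>a t. t \<noteq> 0 \<and> closed_segment a (a + t *\<^sub>R v) \<subseteq> K)"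
  shows "lipschitz_dim (submetric euclidean_metric K) \<le> enat (CARD('n) - 1)"
proof -
  obtain v :: "real ^ 'n" where "v \<in> sphere 0 1"
    and no_seg: "\<And>a t. t \<noteq> 0 \<Longrightarrow> \<not> closed_segment a (a + t *\<^sub>R v) \<subseteq> K"
    using assms(3) by blast
  then have v: "norm v = 1" by simp
  define p where "p = (\<lambda>x. x - (x \<bullet> v) *\<^sub>R v)"
  have "linear p" unfolding p_def by (intro linearI) (simp_all add: algebra_simps)
  have p_le: "norm (p x) \<le> norm x" for x
  proof -
    have "(norm (p x))\<^sup>2 = (norm x)\<^sup>2 - (x \<bullet> v)\<^sup>2"
      unfolding power2_norm_eq_inner p_def using v
      by (simp add: inner_diff_left inner_diff_right inner_commute norm_eq_1 power2_eq_square)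
    then show ?thesis by (intro power2_le_imp_le[OF _ norm_ge_zero]) simp
  qed
  have "uniformly_light p {K}"
    unfolding p_def by (rule uniformly_light_compact[OF assms(1) v no_seg])
  then obtain C where C: "C \<ge> 1"
    "\<And>r A x y. \<lbrakk>r > 0; A \<subseteq> K; narrow p A r; (x, y) \<in> (hop A r)\<^sup>*\<rbrakk> \<Longrightarrow> dist x y \<le> C * r"
    using self_covering_linear_light[OF compact_imp_bounded[OF assms(1)] assms(2) _ \<open>linear p\<close>]
    by metis
  define m where "m = CARD('n) - 1"
  obtain f :: "real ^ 'n \<Rightarrow> nat \<Rightarrow> real" where f: "\<And>x i. i \<ge> m \<Longrightarrow> f x i = 0"
    "\<And>x y. L2_set (\<lambda>i. f x i - f y i) {..<m} = norm (p (x - y))"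
    using hyperplane_coordinates[OF v] unfolding p_def m_def DIM_cart DIM_real mult_1_right by metis
  have "lipschitz_light (submetric euclidean_metric K) (Rn_metric m) f"
    unfolding lipschitz_light_def
  proof (intro conjI exI[of _ C] ballI allI impI)
    show "f \<in> mspace (submetric euclidean_metric K) \<rightarrow> mspace (Rn_metric m)"
      using f(1) by auto
    show "C > 0" using C(1) by simp
    fix x y
    have "norm (p (x - y)) \<le> 1 * dist x y" using p_le by (simp add: dist_norm)
    also have "\<dots> \<le> C * dist x y" using C(1) by (intro mult_right_mono) auto
    finally show "mdist (Rn_metric m) (f x) (f y) \<le> C * mdist (submetric euclidean_metric K) x y"
      by (simp add: f(2))
  next
    fix r W U
    assume r: "r > (0::real)" and W: "mdiam (Rn_metric m) W \<le> ennreal r"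
      and U: "U \<in> rcomponents (submetric (submetric euclidean_metric K) (f -` W)) r"
    define A where "A = K \<inter> f -` W"
    have "narrow p A r"
      unfolding narrow_def
    proof (intro ballI)
      fix u w assume "u \<in> A" "w \<in> A"
      then have "f u \<in> W" "f w \<in> W" by (simp_all add: A_def)
      then have "ennreal (mdist (Rn_metric m) (f u) (f w)) \<le> mdiam (Rn_metric m) W"
        unfolding mdiam_def by (elim SUP_upper2) (rule order_refl)
      with W have "ennreal (norm (p (u - w))) \<le> ennreal r"
        by (simp add: f(2))
      with r show "norm (p (u - w)) \<le> r" by (simp add: ennreal_le_iff)
    qed
    obtain a where a: "U = rconnected (submetric (submetric euclidean_metric K) (f -` W)) r `` {a}"
      using U unfolding rcomponents_def by (auto elim: quotientE)
    have chain: "(a, x) \<in> (hop A r)\<^sup>*" if x: "x \<in> U" for x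
      using x unfolding a rconnected_def
      by (auto elim!: rpath_hop_chain simp: A_def)
    have "dist x y \<le> C * r" if "x \<in> U" "y \<in> U" for x y
    proof (rule C(2)[OF r _ \<open>narrow p A r\<close>])
      show "A \<subseteq> K" by (simp add: A_def)
      show "(x, y) \<in> (hop A r)\<^sup>*"
        using chain[OF that(1)] chain[OF that(2)] sym_hop_chain[of A r]
        by (meson rtrancl_trans symD)
    qed
    then show "mdiam (submetric euclidean_metric K) U \<le> ennreal (C * r)"
      unfolding mdiam_def by (auto intro!: SUP_least ennreal_leI)
  qed
  then show ?thesis
    unfolding lipschitz_dim_def m_def[symmetric] by (intro INF_lower) blast
qed

end
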